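(* For every quantaloid $\mathcal{Q}$, the quantaloids $\mathbf{B}(\mathcal{Q})$ and $\mathbf{Bond}(\mathcal{Q})$ are isomorphic.
   Context: A quantaloid is a category whose hom-sets are complete lattices and whose composition preserves arbitrary joins in each variable. A quantaloid homomorphism is a functor preserving joins of arrows; it is an isomorphism of quantaloids if its underlying functor is an isomorphism of categories. For arrows $f:X\to Y$, $g:Y\to Z$, $h:X\to Z$ the implications $h\swarrow f:Y\to Z$ and $g\searrow h:X\to Y$ are determined by $g\circ f\leq h\iff g\leq h\swarrow f\iff f\leq g\searrow h$. A Chu connection from $f:X_1\to Y_1$ to $g:X_2\to Y_2$ is a pair of $\mathcal{Q}$-arrows $(u:X_1\to X_2,\ v:Y_1\to Y_2)$ with $f\swarrow u=v\searrow g$. $\mathcal{Q}$-arrows and Chu connections, with componentwise composition, identities $(1_X,1_Y)$, order and joins, form the quantaloid $\mathbf{ChuCon}(\mathcal{Q})$. For $(u,v),(u',v'):f\to g$ write $(u,v)\sim(u',v')$ if $f\swarrow u=f\swarrow u'$ (equivalently $v\searrow g=v'\searrow g$). This is a congruence compatible with composition and joins; $\mathbf{B}(\mathcal{Q}):=\mathbf{ChuCon}(\mathcal{Q})/\!\sim$ is the quotient quantaloid (same objects, equivalence classes as arrows, induced compositions and joins). A bond from $f:X_1\to Y_1$ to $g:X_2\to Y_2$ is a $\mathcal{Q}$-arrow $b:X_2\to Y_1$ with $f\swarrow(b\searrow f)=b=(g\swarrow b)\searrow g$. The composition of bonds $b:f\to g$, $b':g\to h$ is $$b'\bullet b=(g\swarrow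 b)\searrow b'=((h\swarrow b')\circ(g\swarrow b))\searrow h=b\swarrow(b'\searrow g)=f\swarrow((b'\searrow g)\circ(b\searrow f)).$$ The identity bond on $f$ is $f$. $\mathcal{Q}$-arrows (as objects) and bonds (as morphisms) constitute a quantaloid $\mathbf{Bond}(\mathcal{Q})$ with the local order given by the reversed order of $\mathcal{Q}$-arrows. *)

theory Defs
  imports "HOL-Algebra.Complete_Lattice"
begin

section \<open>Quantaloids\<close>

text \<open>
  Hom-sets are indexed by pairs of objects and are not required to be disjoint, so composition
  takes the three objects involved as arguments: \<open>Comp C X Y Z g f\<close> is the composite of
  \<open>f : X \<rightarrow> Y\<close> and \<open>g : Y \<rightarrow> Z\<close>. The underlying set of arrows from \<open>X\<close> to \<open>Y\<close> is
  \<open>carrier (Hom C X Y)\<close>.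
\<close>

record ('o, 'a) quantaloid_data =
  Obj :: "'o set"
  Hom :: "'o \<Rightarrow> 'o \<Rightarrow> 'a gorder"
  Comp :: "'o \<Rightarrow> 'o \<Rightarrow> 'o \<Rightarrow> 'a \<Rightarrow> 'a \<Rightarrow> 'a"
  Ident :: "'o \<Rightarrow> 'a"

locale category =
  fixes C :: "('o, 'a) quantaloid_data"
  assumes Comp_closed:
      "\<lbrakk>X \<in> Obj C; Y \<in> Obj C; Z \<in> Obj C; f \<in> carrier (Hom C X Y); g \<in> carrier (Hom C Y Z)\<rbrakk>
        \<Longrightarrow> Comp C X Y Z g f \<in> carrier (Hom C X Z)"
    and Ident_closed: "X \<in> Obj C \<Longrightarrow> Ident C X \<in> carrier (Hom C X X)"
    and Comp_assoc:
      "\<lbrakk>W \<in> Obj C; X \<in> Obj C; Y \<in> Obj C; Z \<in> Obj C;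
        f \<in> carrier (Hom C W X); g \<in> carrier (Hom C X Y); h \<in> carrier (Hom C Y Z)\<rbrakk>
        \<Longrightarrow> Comp C W X Z (Comp C X Y Z h g) f = Comp C W Y Z h (Comp C W X Y g f)"
    and Comp_Ident_right:
      "\<lbrakk>X \<in> Obj C; Y \<in> Obj C; f \<in> carrier (Hom C X Y)\<rbrakk> \<Longrightarrow> Comp C X X Y f (Ident C X) = f"
    and Comp_Ident_left:
      "\<lbrakk>X \<in> Obj C; Y \<in> Obj C; f \<in> carrier (Hom C X Y)\<rbrakk> \<Longrightarrow> Comp C X Y Y (Ident C Y) f = f"

locale quantaloid = category Q for Q :: "('o, 'a) quantaloid_data" +
  assumes Hom_complete_lattice:
      "\<lbrakk>X \<in> Obj Q; Y \<in> Obj Q\<rbrakk> \<Longrightarrow> complete_lattice (Hom Q X Y)"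
    and Comp_sup_left:
      "\<lbrakk>X \<in> Obj Q; Y \<in> Obj Q; Z \<in> Obj Q; f \<in> carrier (Hom Q X Y); B \<subseteq> carrier (Hom Q Y Z)\<rbrakk>
        \<Longrightarrow> Comp Q X Y Z (\<Squnion>\<^bsub>Hom Q Y Z\<^esub> B) f = \<Squnion>\<^bsub>Hom Q X Z\<^esub> ((\<lambda>g. Comp Q X Y Z g f) ` B)"
    and Comp_sup_right:
      "\<lbrakk>X \<in> Obj Q; Y \<in> Obj Q; Z \<in> Obj Q; A \<subseteq> carrier (Hom Q X Y); g \<in> carrier (Hom Q Y Z)\<rbrakk>
        \<Longrightarrow> Comp Q X Y Z g (\<Squnion>\<^bsub>Hom Q X Y\<^esub> A) = \<Squnion>\<^bsub>Hom Q X Z\<^esub> ((\<lambda>f. Comp Q X Y Z g f) ` A)"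


section \<open>Homomorphisms and isomorphisms\<close>

locale category_functor = source: category C + target: category D
  for C :: "('o, 'a) quantaloid_data" and D :: "('p, 'b) quantaloid_data" +
  fixes Fo :: "'o \<Rightarrow> 'p" and Fa :: "'o \<Rightarrow> 'o \<Rightarrow> 'a \<Rightarrow> 'b"
  assumes Fo_closed: "X \<in> Obj C \<Longrightarrow> Fo X \<in> Obj D"
    and Fa_closed:
      "\<lbrakk>X \<in> Obj C; Y \<in> Obj C; f \<in> carrier (Hom C X Y)\<rbrakk> \<Longrightarrow> Fa X Y f \<in> carrier (Hom D (Fo X) (Fo Y))"
    and Fa_Comp:
      "\<lbrakk>X \<in> Obj C; Y \<in> Obj C; Z \<in> Obj C; f \<in> carrier (Hom C X Y); g \<in> carrier (Hom C Y Z)\<rbrakk>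
        \<Longrightarrow> Fa X Z (Comp C X Y Z g f) = Comp D (Fo X) (Fo Y) (Fo Z) (Fa Y Z g) (Fa X Y f)"
    and Fa_Ident: "X \<in> Obj C \<Longrightarrow> Fa X X (Ident C X) = Ident D (Fo X)"

definition category_isomorphism ::
  "('o, 'a) quantaloid_data \<Rightarrow> ('p, 'b) quantaloid_data \<Rightarrow> ('o \<Rightarrow> 'p) \<Rightarrow> ('o \<Rightarrow> 'o \<Rightarrow> 'a \<Rightarrow> 'b) \<Rightarrow> bool"
where
  "category_isomorphism C D Fo Fa \<longleftrightarrow>
     category_functor C D Fo Fa \<and>
     (\<exists>Go Ga. category_functor D C Go Ga \<and>
        (\<forall>X\<in>Obj C. Go (Fo X) = X) \<and>
        (\<forall>X\<in>Obj C. \<forall>Y\<in>Obj C. \<forall>f\<in>carrier (Hom C X Y). Ga (Fo X) (Fo Y) (Fa X Y f) = f) \<and>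
        (\<forall>X\<in>Obj D. Fo (Go X) = X) \<and>
        (\<forall>X\<in>Obj D. \<forall>Y\<in>Obj D. \<forall>f\<in>carrier (Hom D X Y). Fa (Go X) (Go Y) (Ga X Y f) = f))"

locale quantaloid_homomorphism =
  source: quantaloid C + target: quantaloid D + category_functor C D Fo Fa
  for C :: "('o, 'a) quantaloid_data" and D :: "('p, 'b) quantaloid_data"
    and Fo :: "'o \<Rightarrow> 'p" and Fa :: "'o \<Rightarrow> 'o \<Rightarrow> 'a \<Rightarrow> 'b" +
  assumes Fa_sup:
      "\<lbrakk>X \<in> Obj C; Y \<in> Obj C; A \<subseteq> carrier (Hom C X Y)\<rbrakk>
        \<Longrightarrow> Fa X Y (\<Squnion>\<^bsub>Hom C X Y\<^esub> A) = \<Squnion>\<^bsub>Hom D (Fo X) (Fo Y)\<^esub> (Fa X Y ` A)"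

definition quantaloid_isomorphic ::
  "('o, 'a) quantaloid_data \<Rightarrow> ('p, 'b) quantaloid_data \<Rightarrow> bool"
where
  "quantaloid_isomorphic C D \<longleftrightarrow>
     (\<exists>Fo Fa. quantaloid_homomorphism C D Fo Fa \<and> category_isomorphism C D Fo Fa)"


section \<open>Implications\<close>

text \<open>
  For \<open>f : X \<rightarrow> Y\<close>, \<open>g : Y \<rightarrow> Z\<close> and \<open>h : X \<rightarrow> Z\<close>, \<open>limp Q X Y Z h f : Y \<rightarrow> Z\<close> is \<open>h \<swarrow> f\<close>
  and \<open>rimp Q X Y Z g h : X \<rightarrow> Y\<close> is \<open>g \<searrow> h\<close>. The arguments \<open>X\<close>, \<open>Y\<close>, \<open>Z\<close> are always the
  vertices of the triangle formed by \<open>f\<close>, \<open>g\<close> and \<open>h\<close>.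
\<close>

definition limp :: "('o, 'a) quantaloid_data \<Rightarrow> 'o \<Rightarrow> 'o \<Rightarrow> 'o \<Rightarrow> 'a \<Rightarrow> 'a \<Rightarrow> 'a" where
  "limp Q X Y Z h f =
     (THE k. k \<in> carrier (Hom Q Y Z) \<and>
        (\<forall>g\<in>carrier (Hom Q Y Z). Comp Q X Y Z g f \<sqsubseteq>\<^bsub>Hom Q X Z\<^esub> h \<longleftrightarrow> g \<sqsubseteq>\<^bsub>Hom Q Y Z\<^esub> k))"

definition rimp :: "('o, 'a) quantaloid_data \<Rightarrow> 'o \<Rightarrow> 'o \<Rightarrow> 'o \<Rightarrow> 'a \<Rightarrow> 'a \<Rightarrow> 'a" where
  "rimp Q X Y Z g h =
     (THE k. k \<in> carrier (Hom Q X Y) \<and>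
        (\<forall>f\<in>carrier (Hom Q X Y). Comp Q X Y Z g f \<sqsubseteq>\<^bsub>Hom Q X Z\<^esub> h \<longleftrightarrow> f \<sqsubseteq>\<^bsub>Hom Q X Y\<^esub> k))"

lemma sup_preserving_adjoint_ex1:
  assumes L: "complete_lattice L" and M: "complete_lattice M"
    and cl: "\<And>x. x \<in> carrier L \<Longrightarrow> \<phi> x \<in> carrier M"
    and sup: "\<And>A. A \<subseteq> carrier L \<Longrightarrow> \<phi> (\<Squnion>\<^bsub>L\<^esub> A) = \<Squnion>\<^bsub>M\<^esub> (\<phi> ` A)"
    and h: "h \<in> carrier M"
  shows "\<exists>!k. k \<in> carrier L \<and> (\<forall>x\<in>carrier L. \<phi> x \<sqsubseteq>\<^bsub>M\<^esub> h \<longleftrightarrow> x \<sqsubseteq>\<^bsub>L\<^esub> k)"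
proof (rule ex_ex1I)
  interpret L: complete_lattice L by (rule L)
  interpret M: complete_lattice M by (rule M)
  define A where "A = {x \<in> carrier L. \<phi> x \<sqsubseteq>\<^bsub>M\<^esub> h}"
  define k where "k = \<Squnion>\<^bsub>L\<^esub> A"
  have A: "A \<subseteq> carrier L" and \<phi>A: "\<phi> ` A \<subseteq> carrier M"
    by (auto simp: A_def cl)
  have k: "k \<in> carrier L"
    using A by (simp add: k_def)
  have "\<phi> k \<sqsubseteq>\<^bsub>M\<^esub> h"
    unfolding k_def sup[OF A] by (rule M.sup_least) (auto simp: A_def h cl)
  moreover have "\<phi> x \<sqsubseteq>\<^bsub>M\<^esub> \<phi> k" if x: "x \<in> carrier L" "x \<sqsubseteq>\<^bsub>L\<^esub> k" for x
  proof -
    have "\<Squnion>\<^bsub>L\<^esub> {x, k} = k"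
      using x k L.join_le L.join_left L.join_right
      by (metis L.join_closed L.le_antisym L.le_refl join_def)
    hence "\<phi> k = \<Squnion>\<^bsub>M\<^esub> {\<phi> x, \<phi> k}"
      using sup[of "{x, k}"] x k by simp
    thus ?thesis
      using M.join_left[of "\<phi> x" "\<phi> k"] x k cl by (simp add: join_def)
  qed
  moreover have "x \<sqsubseteq>\<^bsub>L\<^esub> k" if "x \<in> carrier L" "\<phi> x \<sqsubseteq>\<^bsub>M\<^esub> h" for x
    unfolding k_def by (rule L.sup_upper[OF A]) (use that in \<open>simp add: A_def\<close>)
  ultimately show "\<exists>k. k \<in> carrier L \<and> (\<forall>x\<in>carrier L. \<phi> x \<sqsubseteq>\<^bsub>M\<^esub> h \<longleftrightarrow> x \<sqsubseteq>\<^bsub>L\<^esub> k)"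
    using k h cl by (meson M.le_trans)
  fix k k'
  assume "k \<in> carrier L \<and> (\<forall>x\<in>carrier L. \<phi> x \<sqsubseteq>\<^bsub>M\<^esub> h \<longleftrightarrow> x \<sqsubseteq>\<^bsub>L\<^esub> k)"
    "k' \<in> carrier L \<and> (\<forall>x\<in>carrier L. \<phi> x \<sqsubseteq>\<^bsub>M\<^esub> h \<longleftrightarrow> x \<sqsubseteq>\<^bsub>L\<^esub> k')"
  thus "k = k'"
    by (meson L.le_antisym L.le_refl)
qed

context quantaloid
begin

lemma limp_adjoint:
  assumes "X \<in> Obj Q" "Y \<in> Obj Q" "Z \<in> Obj Q"
    and "f \<in> carrier (Hom Q X Y)" "h \<in> carrier (Hom Q X Z)"
  shows "limp Q X Y Z h f \<in> carrier (Hom Q Y Z)"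
    and "g \<in> carrier (Hom Q Y Z) \<Longrightarrow>
      Comp Q X Y Z g f \<sqsubseteq>\<^bsub>Hom Q X Z\<^esub> h \<longleftrightarrow> g \<sqsubseteq>\<^bsub>Hom Q Y Z\<^esub> limp Q X Y Z h f"
proof -
  have "\<exists>!k. k \<in> carrier (Hom Q Y Z) \<and>
      (\<forall>g\<in>carrier (Hom Q Y Z). Comp Q X Y Z g f \<sqsubseteq>\<^bsub>Hom Q X Z\<^esub> h \<longleftrightarrow> g \<sqsubseteq>\<^bsub>Hom Q Y Z\<^esub> k)"
    by (rule sup_preserving_adjoint_ex1)
      (use assms in \<open>auto intro: Hom_complete_lattice Comp_closed simp: Comp_sup_left\<close>)
  from theI'[OF this] show "limp Q X Y Z h f \<in> carrier (Hom Q Y Z)"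
    and "g \<in> carrier (Hom Q Y Z) \<Longrightarrow>
      Comp Q X Y Z g f \<sqsubseteq>\<^bsub>Hom Q X Z\<^esub> h \<longleftrightarrow> g \<sqsubseteq>\<^bsub>Hom Q Y Z\<^esub> limp Q X Y Z h f"
    by (auto simp: limp_def)
qed

lemma rimp_adjoint:
  assumes "X \<in> Obj Q" "Y \<in> Obj Q" "Z \<in> Obj Q"
    and "g \<in> carrier (Hom Q Y Z)" "h \<in> carrier (Hom Q X Z)"
  shows "rimp Q X Y Z g h \<in> carrier (Hom Q X Y)"
    and "f \<in> carrier (Hom Q X Y) \<Longrightarrow>
      Comp Q X Y Z g f \<sqsubseteq>\<^bsub>Hom Q X Z\<^esub> h \<longleftrightarrow> f \<sqsubseteq>\<^bsub>Hom Q X Y\<^esub> rimp Q X Y Z g h"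
proof -
  have "\<exists>!k. k \<in> carrier (Hom Q X Y) \<and>
      (\<forall>f\<in>carrier (Hom Q X Y). Comp Q X Y Z g f \<sqsubseteq>\<^bsub>Hom Q X Z\<^esub> h \<longleftrightarrow> f \<sqsubseteq>\<^bsub>Hom Q X Y\<^esub> k)"
    by (rule sup_preserving_adjoint_ex1)
      (use assms in \<open>auto intro: Hom_complete_lattice Comp_closed simp: Comp_sup_right\<close>)
  from theI'[OF this] show "rimp Q X Y Z g h \<in> carrier (Hom Q X Y)"
    and "f \<in> carrier (Hom Q X Y) \<Longrightarrow>
      Comp Q X Y Z g f \<sqsubseteq>\<^bsub>Hom Q X Z\<^esub> h \<longleftrightarrow> f \<sqsubseteq>\<^bsub>Hom Q X Y\<^esub> rimp Q X Y Z g h"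
    by (auto simp: rimp_def)
qed

end


section \<open>Chu connections\<close>

text \<open>
  Since hom-sets may overlap, an arrow regarded as an object is a triple \<open>(X, Y, f)\<close>
  with \<open>f : X \<rightarrow> Y\<close>.
\<close>

type_synonym ('o, 'a) arrow = "'o \<times> 'o \<times> 'a"

definition arrows :: "('o, 'a) quantaloid_data \<Rightarrow> ('o, 'a) arrow set" where
  "arrows Q = {(X, Y, f). X \<in> Obj Q \<and> Y \<in> Obj Q \<and> f \<in> carrier (Hom Q X Y)}"

definition chu_connections ::
  "('o, 'a) quantaloid_data \<Rightarrow> ('o, 'a) arrow \<Rightarrow> ('o, 'a) arrow \<Rightarrow> ('a \<times> 'a) set"
where
  "chu_connections Q = (\<lambda>(X1, Y1, f) (X2, Y2, g).
     {(u, v). u \<in> carrier (Hom Q X1 X2) \<and> v \<in> carrier (Hom Q Y1 Y2) \<and>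
        limp Q X1 X2 Y1 f u = rimp Q X2 Y1 Y2 v g})"

definition ChuCon ::
  "('o, 'a) quantaloid_data \<Rightarrow> (('o, 'a) arrow, 'a \<times> 'a) quantaloid_data"
where
  "ChuCon Q = \<lparr>
     Obj = arrows Q,
     Hom = (\<lambda>(X1, Y1, f) (X2, Y2, g). \<lparr>
       carrier = chu_connections Q (X1, Y1, f) (X2, Y2, g),
       eq = (=),
       le = (\<lambda>(u, v) (u', v'). u \<sqsubseteq>\<^bsub>Hom Q X1 X2\<^esub> u' \<and> v \<sqsubseteq>\<^bsub>Hom Q Y1 Y2\<^esub> v')\<rparr>),
     Comp = (\<lambda>(X1, Y1, f) (X2, Y2, g) (X3, Y3, h) (u', v') (u, v).
       (Comp Q X1 X2 X3 u' u, Comp Q Y1 Y2 Y3 v' v)),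
     Ident = (\<lambda>(X, Y, f). (Ident Q X, Ident Q Y))\<rparr>"

definition chu_equiv ::
  "('o, 'a) quantaloid_data \<Rightarrow> ('o, 'a) arrow \<Rightarrow> ('o, 'a) arrow \<Rightarrow> (('a \<times> 'a) \<times> ('a \<times> 'a)) set"
where
  "chu_equiv Q = (\<lambda>(X1, Y1, f) (X2, Y2, g).
     {((u, v), (u', v')).
        (u, v) \<in> chu_connections Q (X1, Y1, f) (X2, Y2, g) \<and>
        (u', v') \<in> chu_connections Q (X1, Y1, f) (X2, Y2, g) \<and>
        limp Q X1 X2 Y1 f u = limp Q X1 X2 Y1 f u'})"

text \<open>
  The quotient of a quantaloid by a congruence \<open>R\<close>, given as a family of relations on the
  hom-sets. Composites of classes are the classes of composites of representatives. The order
  is the one belonging to the induced joins: \<open>[c] \<le> [d]\<close> iff \<open>[c \<squnion> d] = [d]\<close>.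
\<close>

definition quotient_quantaloid ::
  "('o, 'a) quantaloid_data \<Rightarrow> ('o \<Rightarrow> 'o \<Rightarrow> ('a \<times> 'a) set) \<Rightarrow> ('o, 'a set) quantaloid_data"
where
  "quotient_quantaloid Q R = \<lparr>
     Obj = Obj Q,
     Hom = (\<lambda>X Y. \<lparr>
       carrier = carrier (Hom Q X Y) // R X Y,
       eq = (=),
       le = (\<lambda>c d. \<exists>x\<in>c. \<exists>y\<in>d. (x \<squnion>\<^bsub>Hom Q X Y\<^esub> y, y) \<in> R X Y)\<rparr>),
     Comp = (\<lambda>X Y Z d c. R X Z `` {Comp Q X Y Z y x |x y. x \<in> c \<and> y \<in> d}),
     Ident = (\<lambda>X. R X X `` {Ident Q X})\<rparr>"

definition B_quantaloid ::
  "('o, 'a) quantaloid_data \<Rightarrow> (('o, 'a) arrow, ('a \<times> 'a) set) quantaloid_data"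
where
  "B_quantaloid Q = quotient_quantaloid (ChuCon Q) (chu_equiv Q)"


section \<open>Bonds\<close>

definition bonds ::
  "('o, 'a) quantaloid_data \<Rightarrow> ('o, 'a) arrow \<Rightarrow> ('o, 'a) arrow \<Rightarrow> 'a set"
where
  "bonds Q = (\<lambda>(X1, Y1, f) (X2, Y2, g).
     {b \<in> carrier (Hom Q X2 Y1).
        limp Q X1 X2 Y1 f (rimp Q X1 X2 Y1 b f) = b \<and>
        rimp Q X2 Y1 Y2 (limp Q X2 Y1 Y2 g b) g = b})"

text \<open>
  The composite of bonds \<open>b : f \<rightarrow> g\<close> and \<open>b' : g \<rightarrow> h\<close> is \<open>(g \<swarrow> b) \<searrow> b'\<close>; bonds are ordered
  by the reverse of the order of \<open>Q\<close>.
\<close>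

definition Bond ::
  "('o, 'a) quantaloid_data \<Rightarrow> (('o, 'a) arrow, 'a) quantaloid_data"
where
  "Bond Q = \<lparr>
     Obj = arrows Q,
     Hom = (\<lambda>(X1, Y1, f) (X2, Y2, g).
       inv_gorder ((Hom Q X2 Y1)\<lparr>carrier := bonds Q (X1, Y1, f) (X2, Y2, g)\<rparr>)),
     Comp = (\<lambda>(X1, Y1, f) (X2, Y2, g) (X3, Y3, h) b' b.
       rimp Q X3 Y1 Y2 (limp Q X2 Y1 Y2 g b) b'),
     Ident = (\<lambda>(X, Y, f). f)\<rparr>"

end

theory Submission
  imports Defs
begin

text \<open>
  Both quantaloids are images of the quantaloid of Chu connections, and the isomorphism is an
  instance of the first isomorphism theorem. For a Chu connection \<open>(u, v) : f \<rightarrow> g\<close> put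
  \<open>\<phi>(u, v) = f \<swarrow> u = v \<searrow> g\<close>. Two connections are congruent exactly if \<open>\<phi>\<close> identifies them, so the
  quotient is by the kernel of \<open>\<phi>\<close>; it remains to see that \<open>\<phi>\<close> is a join-preserving functor onto the
  quantaloid of bonds, being the identity on objects.

  \<^item> Values and fullness (\<open>chu_bond_image\<close>): in the Galois connection \<open>(f \<swarrow> -, - \<searrow> f)\<close> the arrows
    of the form \<open>f \<swarrow> u\<close> are the closed ones, and likewise for \<open>v \<searrow> g\<close>. Being of both forms is what
    it means to be a bond, and a bond \<open>b\<close> is the value of \<open>\<phi>\<close> at \<open>(b \<searrow> f, g \<swarrow> b)\<close>.
  \<^item> Composition (\<open>chu_bond_Comp\<close>): with \<open>b = f \<swarrow> u\<close> and \<open>b' = g \<swarrow> u'\<close>,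
    \<open>(g \<swarrow> b) \<searrow> (g \<swarrow> u') = ((g \<swarrow> b) \<searrow> g) \<swarrow> u' = b \<swarrow> u' = f \<swarrow> (u' \<circ> u)\<close>.
  \<^item> Joins (\<open>chu_bond_lub\<close>): \<open>f \<swarrow> -\<close> turns joins into meets, and bonds carry the reversed order.

  The general part (\<open>target_quantaloid\<close>, \<open>quotient_isomorphic\<close>) says that a full image of a quantaloid
  under such a map is a quantaloid, isomorphic to the quotient by the kernel. Hence neither the
  quantaloid laws for bonds nor those for the quotient are verified by hand: they are inherited from
  Chu connections, whose composites and joins are componentwise (\<open>ChuCon_quantaloid\<close>).
\<close>

section \<open>Orders presented by least upper bounds\<close>

lemma partial_orderI:
  assumes eq: "eq L = (=)"
    and refl: "\<And>x. x \<in> carrier L \<Longrightarrow> x \<sqsubseteq>\<^bsub>L\<^esub> x"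
    and antisym: "\<And>x y. \<lbrakk>x \<in> carrier L; y \<in> carrier L; x \<sqsubseteq>\<^bsub>L\<^esub> y; y \<sqsubseteq>\<^bsub>L\<^esub> x\<rbrakk> \<Longrightarrow> x = y"
    and trans: "\<And>x y z. \<lbrakk>x \<in> carrier L; y \<in> carrier L; z \<in> carrier L; x \<sqsubseteq>\<^bsub>L\<^esub> y; y \<sqsubseteq>\<^bsub>L\<^esub> z\<rbrakk>
      \<Longrightarrow> x \<sqsubseteq>\<^bsub>L\<^esub> z"
  shows "partial_order L"
  by unfold_locales (simp_all add: eq refl, (blast intro: antisym trans)+)

context partial_order
begin

text \<open>
  A least upper bound is determined by what lies above it; in this form joins can be compared by
  rewriting, without a separate argument for being an upper bound and for being least.
\<close>

lemma is_lub_iff: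
  assumes "A \<subseteq> carrier L"
  shows "is_lub L s A \<longleftrightarrow>
    s \<in> carrier L \<and> (\<forall>t\<in>carrier L. s \<sqsubseteq> t \<longleftrightarrow> (\<forall>a\<in>A. a \<sqsubseteq> t))"
proof
  assume s: "is_lub L s A"
  then have s': "s \<in> carrier L" by simp
  moreover have "s \<sqsubseteq> t \<longleftrightarrow> (\<forall>a\<in>A. a \<sqsubseteq> t)" if t: "t \<in> carrier L" for t
  proof
    assume "s \<sqsubseteq> t"
    then show "\<forall>a\<in>A. a \<sqsubseteq> t"
      using le_trans[OF least_Upper_above[OF s _ assms]] assms s' t by blast
  next
    assume "\<forall>a\<in>A. a \<sqsubseteq> t"
    then show "s \<sqsubseteq> t"
      using t by (intro least_le[OF s] Upper_memI) auto
  qed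
  ultimately show "s \<in> carrier L \<and> (\<forall>t\<in>carrier L. s \<sqsubseteq> t \<longleftrightarrow> (\<forall>a\<in>A. a \<sqsubseteq> t))"
    by blast
next
  assume s: "s \<in> carrier L \<and> (\<forall>t\<in>carrier L. s \<sqsubseteq> t \<longleftrightarrow> (\<forall>a\<in>A. a \<sqsubseteq> t))"
  with assms show "is_lub L s A"
    by (intro least_UpperI) (auto simp: Upper_def)
qed

lemma sup_eqI: "is_lub L s A \<Longrightarrow> \<Squnion>A = s"
  unfolding sup_def by (rule some_equality) (auto intro: least_unique)

text \<open>
  Joins suffice: the meet of \<open>A\<close> is the join of its lower bounds.
\<close>

lemma complete_lattice_of_lubs:
  assumes "\<And>A. A \<subseteq> carrier L \<Longrightarrow> \<exists>s. is_lub L s A"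
  shows "complete_lattice L"
proof (rule complete_latticeI)
  fix A assume A: "A \<subseteq> carrier L"
  then show "\<exists>s. is_lub L s A" by (rule assms)
  have B: "Lower L A \<subseteq> carrier L" by simp
  then obtain i where i: "is_lub L i (Lower L A)" using assms by blast
  have "is_glb L i A"
  proof (rule greatest_LowerI)
    fix a assume a: "a \<in> A"
    show "i \<sqsubseteq> a"
      by (rule least_le[OF i], rule Upper_memI) (use A a in \<open>auto simp: Lower_def\<close>)
  next
    fix y assume "y \<in> Lower L A"
    then show "y \<sqsubseteq> i" using least_Upper_above[OF i _ B] by blast
  next
    show "A \<subseteq> carrier L" "i \<in> carrier L" using A i by auto
  qed
  then show "\<exists>i. is_glb L i A" ..
qed

end

lemma (in complete_lattice) sup_le_iff:
  "\<lbrakk>A \<subseteq> carrier L; t \<in> carrier L\<rbrakk> \<Longrightarrow> \<Squnion>A \<sqsubseteq> t \<longleftrightarrow> (\<forall>a\<in>A. a \<sqsubseteq> t)"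
  using is_lub_iff[of A "\<Squnion>A"] sup_lub[of A] by simp


context quantaloid
begin

lemma Hom_partial_order: "\<lbrakk>X \<in> Obj Q; Y \<in> Obj Q\<rbrakk> \<Longrightarrow> partial_order (Hom Q X Y)"
  using Hom_complete_lattice
  by (simp add: complete_lattice_def lattice_def upper_semilattice_def)

lemma Hom_sup_closed:
  assumes "X \<in> Obj Q" "Y \<in> Obj Q" "A \<subseteq> carrier (Hom Q X Y)"
  shows "\<Squnion>\<^bsub>Hom Q X Y\<^esub> A \<in> carrier (Hom Q X Y)"
proof -
  interpret complete_lattice "Hom Q X Y" using assms by (intro Hom_complete_lattice)
  show ?thesis using assms by simp
qed

end


section \<open>Full images and kernels of quantaloid homomorphisms\<close>

text \<open>
  The data \<open>D\<close> are only required to have partially ordered hom-sets. That \<open>\<phi>\<close> reaches every arrow and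
  sends joins to least upper bounds forces the rest of the quantaloid structure on \<open>D\<close>. Stating
  preservation of joins through \<open>is_lub\<close> avoids presupposing that joins exist in \<open>D\<close>.
\<close>

locale full_quantaloid_image = source: quantaloid C
  for C :: "('o, 'a) quantaloid_data" +
  fixes D :: "('o, 'b) quantaloid_data" and \<phi> :: "'o \<Rightarrow> 'o \<Rightarrow> 'a \<Rightarrow> 'b"
  assumes Obj_eq: "Obj D = Obj C"
    and Hom_partial_order: "\<lbrakk>X \<in> Obj C; Y \<in> Obj C\<rbrakk> \<Longrightarrow> partial_order (Hom D X Y)"
    and image: "\<lbrakk>X \<in> Obj C; Y \<in> Obj C\<rbrakk> \<Longrightarrow> \<phi> X Y ` carrier (Hom C X Y) = carrier (Hom D X Y)"
    and Comp: "\<lbrakk>X \<in> Obj C; Y \<in> Obj C; Z \<in> Obj C; f \<in> carrier (Hom C X Y); g \<in> carrier (Hom C Y Z)\<rbrakk>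
      \<Longrightarrow> \<phi> X Z (Comp C X Y Z g f) = Comp D X Y Z (\<phi> Y Z g) (\<phi> X Y f)"
    and Ident: "X \<in> Obj C \<Longrightarrow> \<phi> X X (Ident C X) = Ident D X"
    and lub: "\<lbrakk>X \<in> Obj C; Y \<in> Obj C; A \<subseteq> carrier (Hom C X Y)\<rbrakk>
      \<Longrightarrow> is_lub (Hom D X Y) (\<phi> X Y (\<Squnion>\<^bsub>Hom C X Y\<^esub> A)) (\<phi> X Y ` A)"
begin

lemma closed: "\<lbrakk>X \<in> Obj C; Y \<in> Obj C; f \<in> carrier (Hom C X Y)\<rbrakk> \<Longrightarrow> \<phi> X Y f \<in> carrier (Hom D X Y)"
  using image[of X Y] by (metis imageI)

lemma preimage:
  assumes "X \<in> Obj C" "Y \<in> Obj C" "d \<in> carrier (Hom D X Y)"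
  obtains f where "f \<in> carrier (Hom C X Y)" "\<phi> X Y f = d"
  using assms(3) unfolding image[OF assms(1,2), symmetric] by blast

lemma sup: "\<lbrakk>X \<in> Obj C; Y \<in> Obj C; A \<subseteq> carrier (Hom C X Y)\<rbrakk>
    \<Longrightarrow> \<Squnion>\<^bsub>Hom D X Y\<^esub> (\<phi> X Y ` A) = \<phi> X Y (\<Squnion>\<^bsub>Hom C X Y\<^esub> A)"
  by (intro partial_order.sup_eqI Hom_partial_order lub)

lemma preimage_set:
  assumes "X \<in> Obj C" "Y \<in> Obj C" "A \<subseteq> carrier (Hom D X Y)"
  obtains A' where "A' \<subseteq> carrier (Hom C X Y)" "A = \<phi> X Y ` A'"
  using assms(3) unfolding image[OF assms(1,2), symmetric] subset_image_iff by blast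

text \<open>
  Every arrow and every set of arrows of \<open>D\<close> can be lifted along \<open>\<phi>\<close>, so each law of \<open>D\<close> is the image
  of the same law of \<open>C\<close>.
\<close>

lemma target_quantaloid: "quantaloid D"
proof (intro quantaloid.intro quantaloid_axioms.intro category.intro)
  fix X Y Z f g
  assume O: "X \<in> Obj D" "Y \<in> Obj D" "Z \<in> Obj D"
    and f: "f \<in> carrier (Hom D X Y)" and g: "g \<in> carrier (Hom D Y Z)"
  note O = O[unfolded Obj_eq]
  obtain f' where f': "f' \<in> carrier (Hom C X Y)" "\<phi> X Y f' = f" by (rule preimage[OF O(1,2) f])
  obtain g' where g': "g' \<in> carrier (Hom C Y Z)" "\<phi> Y Z g' = g" by (rule preimage[OF O(2,3) g])
  have "\<phi> X Z (Comp C X Y Z g' f') \<in> carrier (Hom D X Z)"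
    using O f'(1) g'(1) by (intro closed source.Comp_closed)
  then show "Comp D X Y Z g f \<in> carrier (Hom D X Z)"
    using O f' g' by (simp add: Comp)
next
  fix X assume "X \<in> Obj D"
  then show "Ident D X \<in> carrier (Hom D X X)"
    unfolding Obj_eq by (simp add: Ident[symmetric] closed source.Ident_closed)
next
  fix W X Y Z f g h
  assume O: "W \<in> Obj D" "X \<in> Obj D" "Y \<in> Obj D" "Z \<in> Obj D"
    and f: "f \<in> carrier (Hom D W X)" and g: "g \<in> carrier (Hom D X Y)" and h: "h \<in> carrier (Hom D Y Z)"
  note O = O[unfolded Obj_eq]
  obtain f' where f': "f' \<in> carrier (Hom C W X)" "\<phi> W X f' = f" by (rule preimage[OF O(1,2) f])
  obtain g' where g': "g' \<in> carrier (Hom C X Y)" "\<phi> X Y g' = g" by (rule preimage[OF O(2,3) g])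
  obtain h' where h': "h' \<in> carrier (Hom C Y Z)" "\<phi> Y Z h' = h" by (rule preimage[OF O(3,4) h])
  show "Comp D W X Z (Comp D X Y Z h g) f = Comp D W Y Z h (Comp D W X Y g f)"
    unfolding f'(2)[symmetric] g'(2)[symmetric] h'(2)[symmetric]
    using O f'(1) g'(1) h'(1) by (simp add: Comp[symmetric] source.Comp_closed source.Comp_assoc)
next
  fix X Y f assume O: "X \<in> Obj D" "Y \<in> Obj D" and f: "f \<in> carrier (Hom D X Y)"
  note O = O[unfolded Obj_eq]
  obtain f' where f': "f' \<in> carrier (Hom C X Y)" "\<phi> X Y f' = f" by (rule preimage[OF O f])
  show "Comp D X X Y f (Ident D X) = f" "Comp D X Y Y (Ident D Y) f = f"
    unfolding f'(2)[symmetric] using O f'(1)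
    by (simp_all add: Ident[symmetric] Comp[symmetric] source.Ident_closed
        source.Comp_Ident_right source.Comp_Ident_left)
next
  fix X Y assume O: "X \<in> Obj D" "Y \<in> Obj D"
  note O = O[unfolded Obj_eq]
  show "complete_lattice (Hom D X Y)"
  proof (rule partial_order.complete_lattice_of_lubs[OF Hom_partial_order[OF O]])
    fix A assume "A \<subseteq> carrier (Hom D X Y)"
    then obtain A' where "A' \<subseteq> carrier (Hom C X Y)" "A = \<phi> X Y ` A'" by (rule preimage_set[OF O])
    then show "\<exists>s. is_lub (Hom D X Y) s A" using lub[OF O] by blast
  qed
next
  fix X Y Z f B
  assume O: "X \<in> Obj D" "Y \<in> Obj D" "Z \<in> Obj D"
    and f: "f \<in> carrier (Hom D X Y)" and B: "B \<subseteq> carrier (Hom D Y Z)"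
  note O = O[unfolded Obj_eq]
  obtain f' where f': "f' \<in> carrier (Hom C X Y)" "\<phi> X Y f' = f" by (rule preimage[OF O(1,2) f])
  obtain B' where B': "B' \<subseteq> carrier (Hom C Y Z)" "B = \<phi> Y Z ` B'" by (rule preimage_set[OF O(2,3) B])
  have "Comp D X Y Z (\<Squnion>\<^bsub>Hom D Y Z\<^esub> B) f = \<phi> X Z (\<Squnion>\<^bsub>Hom C X Z\<^esub> ((\<lambda>g. Comp C X Y Z g f') ` B'))"
    unfolding f'(2)[symmetric] B'(2)
    using O f'(1) B'(1) by (simp add: sup source.Hom_sup_closed Comp[symmetric] source.Comp_sup_left)
  also have "\<dots> = \<Squnion>\<^bsub>Hom D X Z\<^esub> (\<phi> X Z ` (\<lambda>g. Comp C X Y Z g f') ` B')"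
    using O f' B' by (intro sup[symmetric]) (auto intro: source.Comp_closed)
  also have "\<phi> X Z ` (\<lambda>g. Comp C X Y Z g f') ` B' = (\<lambda>g. Comp D X Y Z g f) ` B"
    unfolding B'(2) f'(2)[symmetric] image_image
    using O f'(1) B'(1) by (intro image_cong refl Comp) auto
  finally show "Comp D X Y Z (\<Squnion>\<^bsub>Hom D Y Z\<^esub> B) f = \<Squnion>\<^bsub>Hom D X Z\<^esub> ((\<lambda>g. Comp D X Y Z g f) ` B)" .
next
  fix X Y Z A g
  assume O: "X \<in> Obj D" "Y \<in> Obj D" "Z \<in> Obj D"
    and A: "A \<subseteq> carrier (Hom D X Y)" and g: "g \<in> carrier (Hom D Y Z)"
  note O = O[unfolded Obj_eq]
  obtain g' where g': "g' \<in> carrier (Hom C Y Z)" "\<phi> Y Z g' = g" by (rule preimage[OF O(2,3) g])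
  obtain A' where A': "A' \<subseteq> carrier (Hom C X Y)" "A = \<phi> X Y ` A'" by (rule preimage_set[OF O(1,2) A])
  have "Comp D X Y Z g (\<Squnion>\<^bsub>Hom D X Y\<^esub> A) = \<phi> X Z (\<Squnion>\<^bsub>Hom C X Z\<^esub> (Comp C X Y Z g' ` A'))"
    unfolding g'(2)[symmetric] A'(2)
    using O g'(1) A'(1) by (simp add: sup source.Hom_sup_closed Comp[symmetric] source.Comp_sup_right)
  also have "\<dots> = \<Squnion>\<^bsub>Hom D X Z\<^esub> (\<phi> X Z ` Comp C X Y Z g' ` A')"
    using O g' A' by (intro sup[symmetric]) (auto intro: source.Comp_closed)
  also have "\<phi> X Z ` Comp C X Y Z g' ` A' = Comp D X Y Z g ` A"
    unfolding A'(2) g'(2)[symmetric] image_image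
    using O g'(1) A'(1) by (intro image_cong refl Comp) auto
  finally show "Comp D X Y Z g (\<Squnion>\<^bsub>Hom D X Y\<^esub> A) = \<Squnion>\<^bsub>Hom D X Z\<^esub> (Comp D X Y Z g ` A)" .
qed

text \<open>
  The inverse \<open>\<psi>\<close> of a faithful \<open>\<phi>\<close> inherits functoriality and preservation of joins from \<open>\<phi>\<close>. The
  isomorphism is stated from \<open>D\<close> to \<open>C\<close> because it is used for the fibre map, which goes from the
  image to the quotient.
\<close>

lemma isomorphic_if_faithful:
  assumes inj: "\<And>X Y. \<lbrakk>X \<in> Obj C; Y \<in> Obj C\<rbrakk> \<Longrightarrow> inj_on (\<phi> X Y) (carrier (Hom C X Y))"
  shows "quantaloid_isomorphic D C"
proof -
  define \<psi> where "\<psi> X Y = inv_into (carrier (Hom C X Y)) (\<phi> X Y)" for X Y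
  have \<psi>\<phi>: "\<psi> X Y (\<phi> X Y f) = f" if "X \<in> Obj C" "Y \<in> Obj C" "f \<in> carrier (Hom C X Y)" for X Y f
    using that inj by (simp add: \<psi>_def)
  interpret D: quantaloid D by (rule target_quantaloid)
  have func: "category_functor C D (\<lambda>X. X) \<phi>"
    by unfold_locales (auto simp: Obj_eq closed Comp Ident)
  interpret inverse: quantaloid_homomorphism D C "\<lambda>X. X" \<psi>
  proof
    fix X assume "X \<in> Obj D" then show "X \<in> Obj C" by (simp add: Obj_eq)
  next
    fix X Y f assume "X \<in> Obj D" "Y \<in> Obj D" "f \<in> carrier (Hom D X Y)"
    then show "\<psi> X Y f \<in> carrier (Hom C X Y)"
      unfolding Obj_eq \<psi>_def by (simp add: image[symmetric] inv_into_into)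
  next
    fix X Y Z f g
    assume O: "X \<in> Obj D" "Y \<in> Obj D" "Z \<in> Obj D"
      and fg: "f \<in> carrier (Hom D X Y)" "g \<in> carrier (Hom D Y Z)"
    note O = O[unfolded Obj_eq]
    obtain f' where f': "f' \<in> carrier (Hom C X Y)" "\<phi> X Y f' = f" by (rule preimage[OF O(1,2) fg(1)])
    obtain g' where g': "g' \<in> carrier (Hom C Y Z)" "\<phi> Y Z g' = g" by (rule preimage[OF O(2,3) fg(2)])
    show "\<psi> X Z (Comp D X Y Z g f) = Comp C X Y Z (\<psi> Y Z g) (\<psi> X Y f)"
      unfolding f'(2)[symmetric] g'(2)[symmetric]
      using O f'(1) g'(1) by (simp add: Comp[symmetric] \<psi>\<phi> source.Comp_closed)
  next
    fix X assume "X \<in> Obj D"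
    then show "\<psi> X X (Ident D X) = Ident C X"
      unfolding Obj_eq by (simp add: Ident[symmetric] \<psi>\<phi> source.Ident_closed)
  next
    fix X Y A
    assume O: "X \<in> Obj D" "Y \<in> Obj D" and A: "A \<subseteq> carrier (Hom D X Y)"
    note O = O[unfolded Obj_eq]
    obtain A' where A': "A' \<subseteq> carrier (Hom C X Y)" "A = \<phi> X Y ` A'" by (rule preimage_set[OF O(1,2) A])
    have "\<psi> X Y ` A = A'"
      unfolding A'(2) image_image using A'(1) O \<psi>\<phi>[of X Y] by force
    then show "\<psi> X Y (\<Squnion>\<^bsub>Hom D X Y\<^esub> A) = \<Squnion>\<^bsub>Hom C X Y\<^esub> (\<psi> X Y ` A)"
      using O A' by (simp add: sup \<psi>\<phi> source.Hom_sup_closed)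
  qed
  have "\<phi> X Y (\<psi> X Y d) = d" if "X \<in> Obj C" "Y \<in> Obj C" "d \<in> carrier (Hom D X Y)" for X Y d
    using that unfolding \<psi>_def by (simp add: image[symmetric] f_inv_into_f)
  then have "category_isomorphism D C (\<lambda>X. X) \<psi>"
    unfolding category_isomorphism_def
    using func inverse.category_functor_axioms \<psi>\<phi> Obj_eq
    by (intro conjI exI[of _ "\<lambda>X. X"] exI[of _ \<phi>]) auto
  then show ?thesis
    unfolding quantaloid_isomorphic_def using inverse.quantaloid_homomorphism_axioms by blast
qed

text \<open>
  The left-hand side is the order of the quotient by the kernel of \<open>\<phi>\<close>, expressed on
  representatives: it agrees with the order of \<open>D\<close>.
\<close>

lemma join_eq_iff:
  assumes "X \<in> Obj C" "Y \<in> Obj C" "x \<in> carrier (Hom C X Y)" "y \<in> carrier (Hom C X Y)"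
  shows "\<phi> X Y (x \<squnion>\<^bsub>Hom C X Y\<^esub> y) = \<phi> X Y y \<longleftrightarrow> \<phi> X Y x \<sqsubseteq>\<^bsub>Hom D X Y\<^esub> \<phi> X Y y"
proof -
  interpret D: partial_order "Hom D X Y" using assms by (intro Hom_partial_order)
  have cl: "\<phi> X Y x \<in> carrier (Hom D X Y)" "\<phi> X Y y \<in> carrier (Hom D X Y)"
    using assms by (auto intro: closed)
  have "is_lub (Hom D X Y) (\<phi> X Y (x \<squnion>\<^bsub>Hom C X Y\<^esub> y)) {\<phi> X Y x, \<phi> X Y y}"
    using lub[of X Y "{x, y}"] assms by (simp add: join_def)
  then have *: "\<phi> X Y (x \<squnion>\<^bsub>Hom C X Y\<^esub> y) \<in> carrier (Hom D X Y)"
    "\<And>t. t \<in> carrier (Hom D X Y) \<Longrightarrow> \<phi> X Y (x \<squnion>\<^bsub>Hom C X Y\<^esub> y) \<sqsubseteq>\<^bsub>Hom D X Y\<^esub> t \<longleftrightarrow>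
      \<phi> X Y x \<sqsubseteq>\<^bsub>Hom D X Y\<^esub> t \<and> \<phi> X Y y \<sqsubseteq>\<^bsub>Hom D X Y\<^esub> t"
    using D.is_lub_iff[of "{\<phi> X Y x, \<phi> X Y y}"] cl by auto
  show ?thesis
    using * cl by (metis D.le_antisym D.le_refl)
qed

text \<open>
  The classes of the kernel are the fibres of \<open>\<phi>\<close>. Taking the fibre of an arrow of \<open>D\<close> is again a full
  join-preserving map, now from the quantaloid \<open>D\<close> onto the quotient; it is faithful since fibres over
  distinct arrows are disjoint and nonempty. Working with this direction needs no choice of
  representatives, and it makes the quotient a quantaloid by \<open>target_quantaloid\<close> once more.
\<close>

theorem quotient_isomorphic:
  assumes R: "\<And>X Y. \<lbrakk>X \<in> Obj C; Y \<in> Obj C\<rbrakk> \<Longrightarrow>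
    R X Y = {(x, y). x \<in> carrier (Hom C X Y) \<and> y \<in> carrier (Hom C X Y) \<and> \<phi> X Y x = \<phi> X Y y}"
  shows "quantaloid_isomorphic (quotient_quantaloid C R) D"
proof -
  let ?P = "quotient_quantaloid C R"
  define fibre where "fibre X Y d = {x \<in> carrier (Hom C X Y). \<phi> X Y x = d}" for X Y d
  have class_eq: "R X Y `` {x} = fibre X Y (\<phi> X Y x)"
    if "X \<in> Obj C" "Y \<in> Obj C" "x \<in> carrier (Hom C X Y)" for X Y x
    using that by (auto simp: R fibre_def)
  have fibre_inj: "inj_on (fibre X Y) (carrier (Hom D X Y))" if "X \<in> Obj C" "Y \<in> Obj C" for X Y
  proof (rule inj_onI)
    fix d e assume "d \<in> carrier (Hom D X Y)" "fibre X Y d = fibre X Y e"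
    then show "d = e" using preimage[OF that] unfolding fibre_def by blast
  qed
  have fibre_nonempty: "\<exists>x. x \<in> fibre X Y d"
    if "X \<in> Obj C" "Y \<in> Obj C" "d \<in> carrier (Hom D X Y)" for X Y d
    using preimage[OF that] unfolding fibre_def by blast
  have carrier: "fibre X Y ` carrier (Hom D X Y) = carrier (Hom ?P X Y)"
    if "X \<in> Obj C" "Y \<in> Obj C" for X Y
    using that by (auto simp: quotient_quantaloid_def quotient_def image[symmetric] class_eq)
  have le: "fibre X Y d \<sqsubseteq>\<^bsub>Hom ?P X Y\<^esub> fibre X Y e \<longleftrightarrow> d \<sqsubseteq>\<^bsub>Hom D X Y\<^esub> e"
    if O: "X \<in> Obj C" "Y \<in> Obj C" and de: "d \<in> carrier (Hom D X Y)" "e \<in> carrier (Hom D X Y)" for X Y d e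
  proof -
    have "(x \<squnion>\<^bsub>Hom C X Y\<^esub> y, y) \<in> R X Y \<longleftrightarrow> d \<sqsubseteq>\<^bsub>Hom D X Y\<^esub> e"
      if "x \<in> fibre X Y d" "y \<in> fibre X Y e" for x y
      using that O join_eq_iff[OF O, of x y] source.Hom_sup_closed[OF O, of "{x, y}"]
      by (auto simp: R fibre_def join_def)
    moreover obtain x y where "x \<in> fibre X Y d" "y \<in> fibre X Y e"
      using fibre_nonempty O de by blast
    ultimately show ?thesis unfolding quotient_quantaloid_def by auto
  qed
  interpret D: quantaloid D by (rule target_quantaloid)
  interpret fibre: full_quantaloid_image D ?P fibre
  proof (intro full_quantaloid_image.intro full_quantaloid_image_axioms.intro D.quantaloid_axioms)
    show "Obj ?P = Obj D" by (simp add: quotient_quantaloid_def Obj_eq)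
  next
    fix X Y assume O: "X \<in> Obj D" "Y \<in> Obj D"
    note O = O[unfolded Obj_eq]
    then show "fibre X Y ` carrier (Hom D X Y) = carrier (Hom ?P X Y)" by (rule carrier)
    interpret DO: partial_order "Hom D X Y" using O by (rule Hom_partial_order)
    show "partial_order (Hom ?P X Y)"
    proof (rule partial_orderI)
      show "eq (Hom ?P X Y) = (=)" by (simp add: quotient_quantaloid_def)
    next
      fix c d assume "c \<in> carrier (Hom ?P X Y)" "d \<in> carrier (Hom ?P X Y)"
        "c \<sqsubseteq>\<^bsub>Hom ?P X Y\<^esub> d" "d \<sqsubseteq>\<^bsub>Hom ?P X Y\<^esub> c"
      then show "c = d"
        unfolding carrier[OF O, symmetric] using le[OF O] DO.le_antisym by blast
    qed (auto simp: carrier[OF O, symmetric] le[OF O] intro: DO.le_trans)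
    then interpret PO: partial_order "Hom ?P X Y" .
    fix A assume A: "A \<subseteq> carrier (Hom D X Y)"
    interpret DC: complete_lattice "Hom D X Y" 
      using O by (intro D.Hom_complete_lattice) (auto simp: Obj_eq)
    have "fibre X Y ` A \<subseteq> carrier (Hom ?P X Y)" using A carrier[OF O] by blast
    then show "is_lub (Hom ?P X Y) (fibre X Y (\<Squnion>\<^bsub>Hom D X Y\<^esub> A)) (fibre X Y ` A)"
      using A DC.sup_closed[OF A]
      by (auto simp: PO.is_lub_iff carrier[OF O, symmetric] le[OF O] DC.sup_le_iff subset_iff)
  next
    fix X Y Z f g
    assume O: "X \<in> Obj D" "Y \<in> Obj D" "Z \<in> Obj D"
      and f: "f \<in> carrier (Hom D X Y)" and g: "g \<in> carrier (Hom D Y Z)"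
    note O = O[unfolded Obj_eq]
    obtain f' g' where f': "f' \<in> fibre X Y f" and g': "g' \<in> fibre Y Z g"
      using fibre_nonempty O f g by blast
    \<comment> \<open>The set of composites of representatives may be a proper part of the fibre over the composite;
      since the two fibres are nonempty, it generates that whole class.\<close>
    have "Comp C X Y Z y x \<in> carrier (Hom C X Z) \<and> \<phi> X Z (Comp C X Y Z y x) = Comp D X Y Z g f"
      if "x \<in> fibre X Y f" "y \<in> fibre Y Z g" for x y
      using that O by (auto simp: fibre_def Comp source.Comp_closed)
    then have "R X Z `` {Comp C X Y Z y x |x y. x \<in> fibre X Y f \<and> y \<in> fibre Y Z g}
      = fibre X Z (Comp D X Y Z g f)"
      using f' g' O unfolding R[OF O(1,3)] fibre_def by fastforce
    then show "fibre X Z (Comp D X Y Z g f) = Comp ?P X Y Z (fibre Y Z g) (fibre X Y f)"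
      by (simp add: quotient_quantaloid_def)
  next
    fix X assume "X \<in> Obj D"
    then show "fibre X X (Ident D X) = Ident ?P X"
      by (simp add: quotient_quantaloid_def Obj_eq class_eq Ident source.Ident_closed)
  qed
  show ?thesis
    using fibre_inj by (intro fibre.isomorphic_if_faithful) (auto simp: Obj_eq)
qed

end


section \<open>Calculus of implications\<close>

context quantaloid
begin

lemmas limp_closed = limp_adjoint(1)
lemmas rimp_closed = rimp_adjoint(1)

lemma Hom_le_refl: "\<lbrakk>X \<in> Obj Q; Y \<in> Obj Q; f \<in> carrier (Hom Q X Y)\<rbrakk> \<Longrightarrow> f \<sqsubseteq>\<^bsub>Hom Q X Y\<^esub> f"
  by (simp add: Hom_partial_order partial_order.axioms(1) weak_partial_order.le_refl)

lemma Hom_sup_le_iff: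
  "\<lbrakk>X \<in> Obj Q; Y \<in> Obj Q; A \<subseteq> carrier (Hom Q X Y); t \<in> carrier (Hom Q X Y)\<rbrakk>
    \<Longrightarrow> \<Squnion>\<^bsub>Hom Q X Y\<^esub> A \<sqsubseteq>\<^bsub>Hom Q X Y\<^esub> t \<longleftrightarrow> (\<forall>a\<in>A. a \<sqsubseteq>\<^bsub>Hom Q X Y\<^esub> t)"
  by (intro complete_lattice.sup_le_iff Hom_complete_lattice)

text \<open>
  Arrows with the same lower bounds are equal. The adjunctions describe the lower bounds of an
  implication, so this reduces identities between implications to identities between composites.
\<close>

lemma Hom_eqI:
  assumes "X \<in> Obj Q" "Y \<in> Obj Q" "h \<in> carrier (Hom Q X Y)" "k \<in> carrier (Hom Q X Y)"
    and "\<And>g. g \<in> carrier (Hom Q X Y) \<Longrightarrow> g \<sqsubseteq>\<^bsub>Hom Q X Y\<^esub> h \<longleftrightarrow> g \<sqsubseteq>\<^bsub>Hom Q X Y\<^esub> k"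
  shows "h = k"
  using assms(3,4) assms(5)[of h] assms(5)[of k] Hom_le_refl[OF assms(1,2)]
  by (intro partial_order.le_antisym[OF Hom_partial_order[OF assms(1,2)]]) simp_all

text \<open>
  The next three laws are associativity of composition, transported along the adjunctions.
\<close>

lemma limp_Comp:
  assumes O: "X \<in> Obj Q" "X' \<in> Obj Q" "X'' \<in> Obj Q" "Y \<in> Obj Q"
    and u: "u \<in> carrier (Hom Q X X')" and u': "u' \<in> carrier (Hom Q X' X'')"
    and h: "h \<in> carrier (Hom Q X Y)"
  shows "limp Q X X'' Y h (Comp Q X X' X'' u' u) = limp Q X' X'' Y (limp Q X X' Y h u) u'"
  by (rule Hom_eqI[of X'' Y])
    (use assms in \<open>simp_all add: limp_adjoint(2)[symmetric] limp_closed Comp_closed Comp_assoc\<close>)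

lemma rimp_Comp:
  assumes O: "X \<in> Obj Q" "Y \<in> Obj Q" "Y' \<in> Obj Q" "Y'' \<in> Obj Q"
    and v: "v \<in> carrier (Hom Q Y Y')" and v': "v' \<in> carrier (Hom Q Y' Y'')"
    and h: "h \<in> carrier (Hom Q X Y'')"
  shows "rimp Q X Y Y'' (Comp Q Y Y' Y'' v' v) h = rimp Q X Y Y' v (rimp Q X Y' Y'' v' h)"
  by (rule Hom_eqI[of X Y])
    (use assms in \<open>simp_all add: rimp_adjoint(2)[symmetric] rimp_closed Comp_closed Comp_assoc\<close>)

lemma limp_rimp_commute:
  assumes O: "X \<in> Obj Q" "X' \<in> Obj Q" "Y \<in> Obj Q" "Y' \<in> Obj Q"
    and u: "u \<in> carrier (Hom Q X X')" and v: "v \<in> carrier (Hom Q Y Y')"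
    and h: "h \<in> carrier (Hom Q X Y')"
  shows "limp Q X X' Y (rimp Q X Y Y' v h) u = rimp Q X' Y Y' v (limp Q X X' Y' h u)"
  by (rule Hom_eqI[of X' Y])
    (use assms in \<open>simp_all add: limp_adjoint(2)[symmetric] rimp_adjoint(2)[symmetric]
      limp_closed rimp_closed Comp_closed Comp_assoc\<close>)

lemma limp_Ident:
  assumes "X \<in> Obj Q" "Y \<in> Obj Q" "h \<in> carrier (Hom Q X Y)"
  shows "limp Q X X Y h (Ident Q X) = h"
proof (rule Hom_eqI[OF assms(1,2)])
  fix g assume "g \<in> carrier (Hom Q X Y)"
  then show "g \<sqsubseteq>\<^bsub>Hom Q X Y\<^esub> limp Q X X Y h (Ident Q X) \<longleftrightarrow> g \<sqsubseteq>\<^bsub>Hom Q X Y\<^esub> h"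
    using assms limp_adjoint(2)[of X X Y "Ident Q X" h g] by (simp add: Ident_closed Comp_Ident_right)
qed (use assms in \<open>simp_all add: limp_closed Ident_closed\<close>)

lemma rimp_Ident:
  assumes "X \<in> Obj Q" "Y \<in> Obj Q" "h \<in> carrier (Hom Q X Y)"
  shows "rimp Q X Y Y (Ident Q Y) h = h"
proof (rule Hom_eqI[OF assms(1,2)])
  fix g assume "g \<in> carrier (Hom Q X Y)"
  then show "g \<sqsubseteq>\<^bsub>Hom Q X Y\<^esub> rimp Q X Y Y (Ident Q Y) h \<longleftrightarrow> g \<sqsubseteq>\<^bsub>Hom Q X Y\<^esub> h"
    using assms rimp_adjoint(2)[of X Y Y "Ident Q Y" h g] by (simp add: Ident_closed Comp_Ident_left)
qed (use assms in \<open>simp_all add: rimp_closed Ident_closed\<close>)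

lemma le_limp_sup_iff:
  assumes "X \<in> Obj Q" "X' \<in> Obj Q" "Y \<in> Obj Q" "A \<subseteq> carrier (Hom Q X X')"
    "h \<in> carrier (Hom Q X Y)" "g \<in> carrier (Hom Q X' Y)"
  shows "g \<sqsubseteq>\<^bsub>Hom Q X' Y\<^esub> limp Q X X' Y h (\<Squnion>\<^bsub>Hom Q X X'\<^esub> A) \<longleftrightarrow>
    (\<forall>u\<in>A. g \<sqsubseteq>\<^bsub>Hom Q X' Y\<^esub> limp Q X X' Y h u)"
proof -
  have "g \<sqsubseteq>\<^bsub>Hom Q X' Y\<^esub> limp Q X X' Y h (\<Squnion>\<^bsub>Hom Q X X'\<^esub> A) \<longleftrightarrow>
      \<Squnion>\<^bsub>Hom Q X Y\<^esub> ((\<lambda>u. Comp Q X X' Y g u) ` A) \<sqsubseteq>\<^bsub>Hom Q X Y\<^esub> h"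
    using assms by (simp add: limp_adjoint(2)[symmetric] Hom_sup_closed Comp_sup_right)
  also have "\<dots> \<longleftrightarrow> (\<forall>u\<in>A. Comp Q X X' Y g u \<sqsubseteq>\<^bsub>Hom Q X Y\<^esub> h)"
    using assms by (subst Hom_sup_le_iff) (auto intro: Comp_closed)
  also have "\<dots> \<longleftrightarrow> (\<forall>u\<in>A. g \<sqsubseteq>\<^bsub>Hom Q X' Y\<^esub> limp Q X X' Y h u)"
    using assms by (intro ball_cong refl limp_adjoint(2)) auto
  finally show ?thesis .
qed

lemma le_rimp_sup_iff:
  assumes "X \<in> Obj Q" "Y \<in> Obj Q" "Y' \<in> Obj Q" "A \<subseteq> carrier (Hom Q Y Y')"
    "h \<in> carrier (Hom Q X Y')" "f \<in> carrier (Hom Q X Y)"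
  shows "f \<sqsubseteq>\<^bsub>Hom Q X Y\<^esub> rimp Q X Y Y' (\<Squnion>\<^bsub>Hom Q Y Y'\<^esub> A) h \<longleftrightarrow>
    (\<forall>v\<in>A. f \<sqsubseteq>\<^bsub>Hom Q X Y\<^esub> rimp Q X Y Y' v h)"
proof -
  have "f \<sqsubseteq>\<^bsub>Hom Q X Y\<^esub> rimp Q X Y Y' (\<Squnion>\<^bsub>Hom Q Y Y'\<^esub> A) h \<longleftrightarrow>
      \<Squnion>\<^bsub>Hom Q X Y'\<^esub> ((\<lambda>v. Comp Q X Y Y' v f) ` A) \<sqsubseteq>\<^bsub>Hom Q X Y'\<^esub> h"
    using assms by (simp add: rimp_adjoint(2)[symmetric] Hom_sup_closed Comp_sup_left)
  also have "\<dots> \<longleftrightarrow> (\<forall>v\<in>A. Comp Q X Y Y' v f \<sqsubseteq>\<^bsub>Hom Q X Y'\<^esub> h)"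
    using assms by (subst Hom_sup_le_iff) (auto intro: Comp_closed)
  also have "\<dots> \<longleftrightarrow> (\<forall>v\<in>A. f \<sqsubseteq>\<^bsub>Hom Q X Y\<^esub> rimp Q X Y Y' v h)"
    using assms by (intro ball_cong refl rimp_adjoint(2)) auto
  finally show ?thesis .
qed

lemma le_limp_iff_le_rimp:
  assumes "X \<in> Obj Q" "Y \<in> Obj Q" "Z \<in> Obj Q"
    "f \<in> carrier (Hom Q X Y)" "g \<in> carrier (Hom Q Y Z)" "h \<in> carrier (Hom Q X Z)"
  shows "g \<sqsubseteq>\<^bsub>Hom Q Y Z\<^esub> limp Q X Y Z h f \<longleftrightarrow> f \<sqsubseteq>\<^bsub>Hom Q X Y\<^esub> rimp Q X Y Z g h"
  using assms limp_adjoint(2) rimp_adjoint(2) by simp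

lemma le_limp_rimp:
  assumes "X \<in> Obj Q" "Y \<in> Obj Q" "Z \<in> Obj Q" "g \<in> carrier (Hom Q Y Z)" "h \<in> carrier (Hom Q X Z)"
  shows "g \<sqsubseteq>\<^bsub>Hom Q Y Z\<^esub> limp Q X Y Z h (rimp Q X Y Z g h)"
  using assms by (simp add: le_limp_iff_le_rimp rimp_closed Hom_le_refl)

lemma le_rimp_limp:
  assumes "X \<in> Obj Q" "Y \<in> Obj Q" "Z \<in> Obj Q" "f \<in> carrier (Hom Q X Y)" "h \<in> carrier (Hom Q X Z)"
  shows "f \<sqsubseteq>\<^bsub>Hom Q X Y\<^esub> rimp Q X Y Z (limp Q X Y Z h f) h"
  using assms by (simp add: le_limp_iff_le_rimp[symmetric] limp_closed Hom_le_refl)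

text \<open>
  \<open>h \<swarrow> -\<close> and \<open>- \<searrow> h\<close> form an antitone Galois connection by \<open>le_limp_iff_le_rimp\<close>; this and the next
  lemma are its triangle identities.
\<close>

lemma limp_rimp_limp:
  assumes O: "X \<in> Obj Q" "Y \<in> Obj Q" "Z \<in> Obj Q"
    and f: "f \<in> carrier (Hom Q X Y)" and h: "h \<in> carrier (Hom Q X Z)"
  shows "limp Q X Y Z h (rimp Q X Y Z (limp Q X Y Z h f) h) = limp Q X Y Z h f"
proof -
  interpret YZ: partial_order "Hom Q Y Z" using O by (intro Hom_partial_order)
  interpret XY: partial_order "Hom Q X Y" using O by (intro Hom_partial_order)
  let ?g = "limp Q X Y Z h f" let ?f = "rimp Q X Y Z ?g h"
  have g: "?g \<in> carrier (Hom Q Y Z)" using assms by (intro limp_closed)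
  have f': "?f \<in> carrier (Hom Q X Y)" using O g h by (intro rimp_closed)
  have k: "limp Q X Y Z h ?f \<in> carrier (Hom Q Y Z)" using O f' h by (intro limp_closed)
  have "?f \<sqsubseteq>\<^bsub>Hom Q X Y\<^esub> rimp Q X Y Z (limp Q X Y Z h ?f) h"
    using O f' h by (rule le_rimp_limp)
  then have "f \<sqsubseteq>\<^bsub>Hom Q X Y\<^esub> rimp Q X Y Z (limp Q X Y Z h ?f) h"
    using XY.le_trans[OF le_rimp_limp[OF O f h]] f f' rimp_closed[OF O k h] by blast
  then have "limp Q X Y Z h ?f \<sqsubseteq>\<^bsub>Hom Q Y Z\<^esub> ?g"
    using O f h k by (simp add: le_limp_iff_le_rimp)
  then show ?thesis
    using le_limp_rimp[OF O g h] k g by (intro YZ.le_antisym)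
qed

lemma rimp_limp_rimp:
  assumes O: "X \<in> Obj Q" "Y \<in> Obj Q" "Z \<in> Obj Q"
    and g: "g \<in> carrier (Hom Q Y Z)" and h: "h \<in> carrier (Hom Q X Z)"
  shows "rimp Q X Y Z (limp Q X Y Z h (rimp Q X Y Z g h)) h = rimp Q X Y Z g h"
proof -
  interpret YZ: partial_order "Hom Q Y Z" using O by (intro Hom_partial_order)
  interpret XY: partial_order "Hom Q X Y" using O by (intro Hom_partial_order)
  let ?f = "rimp Q X Y Z g h" let ?g = "limp Q X Y Z h ?f"
  have f: "?f \<in> carrier (Hom Q X Y)" using assms by (intro rimp_closed)
  have g': "?g \<in> carrier (Hom Q Y Z)" using O f h by (intro limp_closed)
  have k: "rimp Q X Y Z ?g h \<in> carrier (Hom Q X Y)" using O g' h by (intro rimp_closed)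
  have "?g \<sqsubseteq>\<^bsub>Hom Q Y Z\<^esub> limp Q X Y Z h (rimp Q X Y Z ?g h)"
    using O g' h by (rule le_limp_rimp)
  then have "g \<sqsubseteq>\<^bsub>Hom Q Y Z\<^esub> limp Q X Y Z h (rimp Q X Y Z ?g h)"
    using YZ.le_trans[OF le_limp_rimp[OF O g h]] g g' limp_closed[OF O k h] by blast
  then have "rimp Q X Y Z ?g h \<sqsubseteq>\<^bsub>Hom Q X Y\<^esub> ?f"
    using O g h k by (simp add: le_limp_iff_le_rimp)
  then show ?thesis
    using le_rimp_limp[OF O f h] k f by (intro XY.le_antisym)
qed


section \<open>The quantaloid of Chu connections\<close>

lemma Obj_ChuCon: "Obj (ChuCon Q) = arrows Q"
  by (simp add: ChuCon_def)

lemma carrier_ChuCon: "carrier (Hom (ChuCon Q) F G) = chu_connections Q F G"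
  by (cases F; cases G) (simp add: ChuCon_def)

lemma le_ChuCon:
  "c \<sqsubseteq>\<^bsub>Hom (ChuCon Q) (X1, Y1, f) (X2, Y2, g)\<^esub> d \<longleftrightarrow>
    fst c \<sqsubseteq>\<^bsub>Hom Q X1 X2\<^esub> fst d \<and> snd c \<sqsubseteq>\<^bsub>Hom Q Y1 Y2\<^esub> snd d"
  by (cases c; cases d) (simp add: ChuCon_def)

lemma Comp_ChuCon:
  "Comp (ChuCon Q) (X1, Y1, f) (X2, Y2, g) (X3, Y3, h) d c =
    (Comp Q X1 X2 X3 (fst d) (fst c), Comp Q Y1 Y2 Y3 (snd d) (snd c))"
  by (cases c; cases d) (simp add: ChuCon_def)

lemma mem_arrows: "(X, Y, f) \<in> arrows Q \<longleftrightarrow> X \<in> Obj Q \<and> Y \<in> Obj Q \<and> f \<in> carrier (Hom Q X Y)"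
  by (simp add: arrows_def)

lemma mem_chu_connections:
  "c \<in> chu_connections Q (X1, Y1, f) (X2, Y2, g) \<longleftrightarrow>
    fst c \<in> carrier (Hom Q X1 X2) \<and> snd c \<in> carrier (Hom Q Y1 Y2) \<and>
    limp Q X1 X2 Y1 f (fst c) = rimp Q X2 Y1 Y2 (snd c) g"
  by (cases c) (simp add: chu_connections_def)

lemma Ident_ChuCon: "Ident (ChuCon Q) (X, Y, f) = (Ident Q X, Ident Q Y)"
  by (simp add: ChuCon_def)

text \<open>
  The defining equations are pasted along \<open>limp_rimp_commute\<close>:
  \<open>f \<swarrow> (u' \<circ> u) = (v \<searrow> g) \<swarrow> u' = v \<searrow> (g \<swarrow> u') = v \<searrow> (v' \<searrow> h) = (v' \<circ> v) \<searrow> h\<close>.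
\<close>

lemma Comp_chu_connection:
  assumes F: "(X1, Y1, f) \<in> arrows Q" and G: "(X2, Y2, g) \<in> arrows Q" and H: "(X3, Y3, h) \<in> arrows Q"
    and c: "c \<in> chu_connections Q (X1, Y1, f) (X2, Y2, g)"
    and d: "d \<in> chu_connections Q (X2, Y2, g) (X3, Y3, h)"
  shows "Comp (ChuCon Q) (X1, Y1, f) (X2, Y2, g) (X3, Y3, h) d c
    \<in> chu_connections Q (X1, Y1, f) (X3, Y3, h)"
proof -
  obtain u v u' v' where cd: "c = (u, v)" "d = (u', v')" by (cases c; cases d)
  have a: "X1 \<in> Obj Q" "Y1 \<in> Obj Q" "X2 \<in> Obj Q" "Y2 \<in> Obj Q" "X3 \<in> Obj Q" "Y3 \<in> Obj Q"
    "f \<in> carrier (Hom Q X1 Y1)" "g \<in> carrier (Hom Q X2 Y2)" "h \<in> carrier (Hom Q X3 Y3)"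
    "u \<in> carrier (Hom Q X1 X2)" "v \<in> carrier (Hom Q Y1 Y2)"
    "u' \<in> carrier (Hom Q X2 X3)" "v' \<in> carrier (Hom Q Y2 Y3)"
    using assms by (auto simp: mem_arrows mem_chu_connections cd)
  have "limp Q X1 X3 Y1 f (Comp Q X1 X2 X3 u' u) = limp Q X2 X3 Y1 (limp Q X1 X2 Y1 f u) u'"
    using a by (intro limp_Comp)
  also have "limp Q X1 X2 Y1 f u = rimp Q X2 Y1 Y2 v g"
    using c by (simp add: mem_chu_connections cd)
  also have "limp Q X2 X3 Y1 (rimp Q X2 Y1 Y2 v g) u' = rimp Q X3 Y1 Y2 v (limp Q X2 X3 Y2 g u')"
    using a by (intro limp_rimp_commute)
  also have "limp Q X2 X3 Y2 g u' = rimp Q X3 Y2 Y3 v' h"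
    using d by (simp add: mem_chu_connections cd)
  also have "rimp Q X3 Y1 Y2 v (rimp Q X3 Y2 Y3 v' h) = rimp Q X3 Y1 Y3 (Comp Q Y1 Y2 Y3 v' v) h"
    using a by (intro rimp_Comp[symmetric])
  finally show ?thesis
    using a by (simp add: mem_chu_connections Comp_ChuCon cd Comp_closed)
qed

text \<open>
  Both implications turn joins in the variable \<open>u\<close> or \<open>v\<close> into meets, so the defining equation
  \<open>f \<swarrow> u = v \<searrow> g\<close> survives componentwise joins. Meets of Chu connections are not componentwise in
  general, which is why the lattice is built from its joins.
\<close>

lemma sup_chu_connection:
  assumes F: "(X1, Y1, f) \<in> arrows Q" and G: "(X2, Y2, g) \<in> arrows Q"
    and A: "A \<subseteq> chu_connections Q (X1, Y1, f) (X2, Y2, g)"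
  shows "(\<Squnion>\<^bsub>Hom Q X1 X2\<^esub> (fst ` A), \<Squnion>\<^bsub>Hom Q Y1 Y2\<^esub> (snd ` A))
    \<in> chu_connections Q (X1, Y1, f) (X2, Y2, g)"
proof -
  have a: "X1 \<in> Obj Q" "Y1 \<in> Obj Q" "X2 \<in> Obj Q" "Y2 \<in> Obj Q"
    "f \<in> carrier (Hom Q X1 Y1)" "g \<in> carrier (Hom Q X2 Y2)"
    using F G by (auto simp: mem_arrows)
  have A': "fst ` A \<subseteq> carrier (Hom Q X1 X2)" "snd ` A \<subseteq> carrier (Hom Q Y1 Y2)"
    and eq: "\<And>c. c \<in> A \<Longrightarrow> limp Q X1 X2 Y1 f (fst c) = rimp Q X2 Y1 Y2 (snd c) g"
    using A by (auto simp: mem_chu_connections subset_iff)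
  have "limp Q X1 X2 Y1 f (\<Squnion>\<^bsub>Hom Q X1 X2\<^esub> (fst ` A)) = rimp Q X2 Y1 Y2 (\<Squnion>\<^bsub>Hom Q Y1 Y2\<^esub> (snd ` A)) g"
    using a A' by (intro Hom_eqI[of X2 Y1])
      (simp_all add: le_limp_sup_iff le_rimp_sup_iff limp_closed rimp_closed Hom_sup_closed eq)
  then show ?thesis
    using a A' by (simp add: mem_chu_connections Hom_sup_closed)
qed

lemma ChuCon_partial_order:
  assumes F: "F \<in> arrows Q" and G: "G \<in> arrows Q"
  shows "partial_order (Hom (ChuCon Q) F G)"
proof -
  obtain X1 Y1 f X2 Y2 g where FG: "F = (X1, Y1, f)" "G = (X2, Y2, g)" by (cases F; cases G)
  have a: "X1 \<in> Obj Q" "Y1 \<in> Obj Q" "X2 \<in> Obj Q" "Y2 \<in> Obj Q"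
    using F G by (auto simp: mem_arrows FG)
  interpret X: partial_order "Hom Q X1 X2" using a by (intro Hom_partial_order)
  interpret Y: partial_order "Hom Q Y1 Y2" using a by (intro Hom_partial_order)
  show ?thesis
    unfolding FG
  proof (rule partial_orderI)
    show "eq (Hom (ChuCon Q) (X1, Y1, f) (X2, Y2, g)) = (=)" by (simp add: ChuCon_def)
  qed (auto simp: carrier_ChuCon mem_chu_connections le_ChuCon prod_eq_iff
      intro: X.le_trans Y.le_trans)
qed

lemma ChuCon_lub:
  assumes F: "(X1, Y1, f) \<in> arrows Q" and G: "(X2, Y2, g) \<in> arrows Q"
    and A: "A \<subseteq> chu_connections Q (X1, Y1, f) (X2, Y2, g)"
  shows "is_lub (Hom (ChuCon Q) (X1, Y1, f) (X2, Y2, g))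
    (\<Squnion>\<^bsub>Hom Q X1 X2\<^esub> (fst ` A), \<Squnion>\<^bsub>Hom Q Y1 Y2\<^esub> (snd ` A)) A"
proof -
  interpret partial_order "Hom (ChuCon Q) (X1, Y1, f) (X2, Y2, g)"
    using F G by (rule ChuCon_partial_order)
  have a: "X1 \<in> Obj Q" "Y1 \<in> Obj Q" "X2 \<in> Obj Q" "Y2 \<in> Obj Q"
    using F G by (auto simp: mem_arrows)
  have A': "fst ` A \<subseteq> carrier (Hom Q X1 X2)" "snd ` A \<subseteq> carrier (Hom Q Y1 Y2)"
    using A by (auto simp: mem_chu_connections subset_iff)
  show ?thesis
    using A A' a sup_chu_connection[OF F G A]
    by (subst is_lub_iff)
      (auto simp: carrier_ChuCon le_ChuCon mem_chu_connections Hom_sup_le_iff)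
qed

lemma ChuCon_sup:
  assumes F: "(X1, Y1, f) \<in> arrows Q" and G: "(X2, Y2, g) \<in> arrows Q"
    and A: "A \<subseteq> chu_connections Q (X1, Y1, f) (X2, Y2, g)"
  shows "\<Squnion>\<^bsub>Hom (ChuCon Q) (X1, Y1, f) (X2, Y2, g)\<^esub> A =
    (\<Squnion>\<^bsub>Hom Q X1 X2\<^esub> (fst ` A), \<Squnion>\<^bsub>Hom Q Y1 Y2\<^esub> (snd ` A))"
  using partial_order.sup_eqI[OF ChuCon_partial_order[OF F G] ChuCon_lub[OF assms]] .

theorem ChuCon_quantaloid: "quantaloid (ChuCon Q)"
proof (intro quantaloid.intro quantaloid_axioms.intro category.intro,
    unfold Obj_ChuCon carrier_ChuCon)
  fix F G H c d
  assume "F \<in> arrows Q" "G \<in> arrows Q" "H \<in> arrows Q"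
    "c \<in> chu_connections Q F G" "d \<in> chu_connections Q G H"
  then show "Comp (ChuCon Q) F G H d c \<in> chu_connections Q F H"
    by (cases F; cases G; cases H) (simp add: Comp_chu_connection)
next
  fix F assume "F \<in> arrows Q"
  then show "Ident (ChuCon Q) F \<in> chu_connections Q F F"
    by (cases F) (simp add: Ident_ChuCon mem_chu_connections mem_arrows Ident_closed limp_Ident rimp_Ident)
next
  fix E F G H b c d
  assume "E \<in> arrows Q" "F \<in> arrows Q" "G \<in> arrows Q" "H \<in> arrows Q"
    "b \<in> chu_connections Q E F" "c \<in> chu_connections Q F G" "d \<in> chu_connections Q G H"
  then show "Comp (ChuCon Q) E F H (Comp (ChuCon Q) F G H d c) b =
      Comp (ChuCon Q) E G H d (Comp (ChuCon Q) E F G c b)"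
    by (cases E; cases F; cases G; cases H)
      (simp add: Comp_ChuCon mem_arrows mem_chu_connections Comp_assoc)
next
  fix F G c
  assume "F \<in> arrows Q" "G \<in> arrows Q" "c \<in> chu_connections Q F G"
  then show "Comp (ChuCon Q) F F G c (Ident (ChuCon Q) F) = c"
    "Comp (ChuCon Q) F G G (Ident (ChuCon Q) G) c = c"
    by (cases F; cases G; simp add: Comp_ChuCon Ident_ChuCon mem_arrows mem_chu_connections
        Comp_Ident_left Comp_Ident_right)+
next
  fix F G assume FG: "F \<in> arrows Q" "G \<in> arrows Q"
  show "complete_lattice (Hom (ChuCon Q) F G)"
  proof (rule partial_order.complete_lattice_of_lubs[OF ChuCon_partial_order[OF FG]])
    fix A assume "A \<subseteq> carrier (Hom (ChuCon Q) F G)"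
    with FG show "\<exists>s. is_lub (Hom (ChuCon Q) F G) s A"
      unfolding carrier_ChuCon by (cases F; cases G) (blast intro: ChuCon_lub)
  qed
next
  fix F G H c B
  assume *: "F \<in> arrows Q" "G \<in> arrows Q" "H \<in> arrows Q"
    "c \<in> chu_connections Q F G" "B \<subseteq> chu_connections Q G H"
  obtain X1 Y1 f X2 Y2 g X3 Y3 h where FGH: "F = (X1, Y1, f)" "G = (X2, Y2, g)" "H = (X3, Y3, h)"
    by (cases F; cases G; cases H)
  have B: "(\<lambda>d. Comp (ChuCon Q) F G H d c) ` B \<subseteq> chu_connections Q F H"
    using * unfolding FGH by (blast intro: Comp_chu_connection)
  have "fst ` B \<subseteq> carrier (Hom Q X2 X3)" "snd ` B \<subseteq> carrier (Hom Q Y2 Y3)"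
    using *(5) by (auto simp: mem_chu_connections subset_iff FGH)
  then show "Comp (ChuCon Q) F G H (\<Squnion>\<^bsub>Hom (ChuCon Q) G H\<^esub> B) c =
      \<Squnion>\<^bsub>Hom (ChuCon Q) F H\<^esub> ((\<lambda>d. Comp (ChuCon Q) F G H d c) ` B)"
    using * B unfolding FGH
    by (simp add: ChuCon_sup) 
      (simp add: Comp_ChuCon mem_arrows mem_chu_connections Comp_sup_left image_image)
next
  fix F G H A d
  assume *: "F \<in> arrows Q" "G \<in> arrows Q" "H \<in> arrows Q"
    "A \<subseteq> chu_connections Q F G" "d \<in> chu_connections Q G H"
  obtain X1 Y1 f X2 Y2 g X3 Y3 h where FGH: "F = (X1, Y1, f)" "G = (X2, Y2, g)" "H = (X3, Y3, h)"
    by (cases F; cases G; cases H)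
  have A: "Comp (ChuCon Q) F G H d ` A \<subseteq> chu_connections Q F H"
    using * unfolding FGH by (blast intro: Comp_chu_connection)
  have "fst ` A \<subseteq> carrier (Hom Q X1 X2)" "snd ` A \<subseteq> carrier (Hom Q Y1 Y2)"
    using *(4) by (auto simp: mem_chu_connections subset_iff FGH)
  then show "Comp (ChuCon Q) F G H d (\<Squnion>\<^bsub>Hom (ChuCon Q) F G\<^esub> A) =
      \<Squnion>\<^bsub>Hom (ChuCon Q) F H\<^esub> (Comp (ChuCon Q) F G H d ` A)"
    using * A unfolding FGH
    by (simp add: ChuCon_sup)
      (simp add: Comp_ChuCon mem_arrows mem_chu_connections Comp_sup_right image_image)
qed


section \<open>From Chu connections to bonds\<close>

lemma Obj_Bond: "Obj (Bond Q) = arrows Q"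
  by (simp add: Bond_def)

lemma carrier_Bond: "carrier (Hom (Bond Q) F G) = bonds Q F G"
  by (cases F; cases G) (simp add: Bond_def)

lemma le_Bond: "b \<sqsubseteq>\<^bsub>Hom (Bond Q) (X1, Y1, f) (X2, Y2, g)\<^esub> b' \<longleftrightarrow> b' \<sqsubseteq>\<^bsub>Hom Q X2 Y1\<^esub> b"
  by (simp add: Bond_def)

lemma Comp_Bond:
  "Comp (Bond Q) (X1, Y1, f) (X2, Y2, g) (X3, Y3, h) b' b =
    rimp Q X3 Y1 Y2 (limp Q X2 Y1 Y2 g b) b'"
  by (simp add: Bond_def)

lemma Ident_Bond: "Ident (Bond Q) (X, Y, f) = f"
  by (simp add: Bond_def)

lemma mem_bonds:
  "b \<in> bonds Q (X1, Y1, f) (X2, Y2, g) \<longleftrightarrow> b \<in> carrier (Hom Q X2 Y1) \<and>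
    limp Q X1 X2 Y1 f (rimp Q X1 X2 Y1 b f) = b \<and> rimp Q X2 Y1 Y2 (limp Q X2 Y1 Y2 g b) g = b"
  by (simp add: bonds_def)

lemma Bond_partial_order:
  assumes F: "F \<in> arrows Q" and G: "G \<in> arrows Q"
  shows "partial_order (Hom (Bond Q) F G)"
proof -
  obtain X1 Y1 f X2 Y2 g where FG: "F = (X1, Y1, f)" "G = (X2, Y2, g)" by (cases F; cases G)
  interpret partial_order "Hom Q X2 Y1"
    using F G by (intro Hom_partial_order) (auto simp: mem_arrows FG)
  show ?thesis
    unfolding FG
  proof (rule partial_orderI)
    show "eq (Hom (Bond Q) (X1, Y1, f) (X2, Y2, g)) = (=)" by (simp add: Bond_def eq_is_equal)
  qed (auto simp: carrier_Bond mem_bonds le_Bond intro: le_trans)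
qed

end

definition chu_bond ::
  "('o, 'a) quantaloid_data \<Rightarrow> ('o, 'a) arrow \<Rightarrow> ('o, 'a) arrow \<Rightarrow> 'a \<times> 'a \<Rightarrow> 'a"
where
  "chu_bond Q = (\<lambda>(X1, Y1, f) (X2, Y2, g) (u, v). limp Q X1 X2 Y1 f u)"

context quantaloid
begin

lemma chu_bond_eq: "chu_bond Q (X1, Y1, f) (X2, Y2, g) c = limp Q X1 X2 Y1 f (fst c)"
  by (cases c) (simp add: chu_bond_def)

text \<open>
  By the triangle identities \<open>f \<swarrow> u\<close> satisfies the first equation of a bond and \<open>v \<searrow> g\<close> the second;
  a Chu connection makes these two arrows coincide. Conversely the two equations of a bond \<open>b\<close> say
  precisely that \<open>(b \<searrow> f, g \<swarrow> b)\<close> is a Chu connection with value \<open>b\<close>.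
\<close>

lemma chu_bond_image:
  assumes F: "(X1, Y1, f) \<in> arrows Q" and G: "(X2, Y2, g) \<in> arrows Q"
  shows "chu_bond Q (X1, Y1, f) (X2, Y2, g) ` chu_connections Q (X1, Y1, f) (X2, Y2, g)
    = bonds Q (X1, Y1, f) (X2, Y2, g)"
proof (intro equalityI subsetI)
  have a: "X1 \<in> Obj Q" "Y1 \<in> Obj Q" "X2 \<in> Obj Q" "Y2 \<in> Obj Q"
    "f \<in> carrier (Hom Q X1 Y1)" "g \<in> carrier (Hom Q X2 Y2)"
    using F G by (auto simp: mem_arrows)
  {
    fix b assume "b \<in> chu_bond Q (X1, Y1, f) (X2, Y2, g) ` chu_connections Q (X1, Y1, f) (X2, Y2, g)"
    then obtain u v where uv: "u \<in> carrier (Hom Q X1 X2)" "v \<in> carrier (Hom Q Y1 Y2)"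
      and b: "b = limp Q X1 X2 Y1 f u" "b = rimp Q X2 Y1 Y2 v g"
      by (auto simp: chu_bond_eq mem_chu_connections)
    have "limp Q X1 X2 Y1 f (rimp Q X1 X2 Y1 b f) = b"
      unfolding b(1) using a uv by (intro limp_rimp_limp)
    moreover have "rimp Q X2 Y1 Y2 (limp Q X2 Y1 Y2 g b) g = b"
      unfolding b(2) using a uv by (intro rimp_limp_rimp)
    moreover have "b \<in> carrier (Hom Q X2 Y1)"
      unfolding b(1) using a uv by (intro limp_closed)
    ultimately show "b \<in> bonds Q (X1, Y1, f) (X2, Y2, g)"
      by (simp add: mem_bonds)
  next
    fix b assume "b \<in> bonds Q (X1, Y1, f) (X2, Y2, g)"
    then have b: "b \<in> carrier (Hom Q X2 Y1)"
      "limp Q X1 X2 Y1 f (rimp Q X1 X2 Y1 b f) = b" "rimp Q X2 Y1 Y2 (limp Q X2 Y1 Y2 g b) g = b"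
      by (auto simp: mem_bonds)
    let ?c = "(rimp Q X1 X2 Y1 b f, limp Q X2 Y1 Y2 g b)"
    have "?c \<in> chu_connections Q (X1, Y1, f) (X2, Y2, g)"
      using a b by (simp add: mem_chu_connections limp_closed rimp_closed)
    moreover have "chu_bond Q (X1, Y1, f) (X2, Y2, g) ?c = b"
      using b by (simp add: chu_bond_eq)
    ultimately show "b \<in> chu_bond Q (X1, Y1, f) (X2, Y2, g) ` chu_connections Q (X1, Y1, f) (X2, Y2, g)"
      by (metis imageI)
  }
qed

text \<open>
  The argument moves \<open>u'\<close> out of the composite of bonds by \<open>limp_rimp_commute\<close>, after which
  \<open>(g \<swarrow> b) \<searrow> g\<close> collapses to \<open>b\<close> because \<open>b = v \<searrow> g\<close>.
\<close>

lemma chu_bond_Comp: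
  assumes F: "(X1, Y1, f) \<in> arrows Q" and G: "(X2, Y2, g) \<in> arrows Q" and H: "(X3, Y3, h) \<in> arrows Q"
    and c: "c \<in> chu_connections Q (X1, Y1, f) (X2, Y2, g)"
    and d: "d \<in> chu_connections Q (X2, Y2, g) (X3, Y3, h)"
  shows "chu_bond Q (X1, Y1, f) (X3, Y3, h) (Comp (ChuCon Q) (X1, Y1, f) (X2, Y2, g) (X3, Y3, h) d c)
    = Comp (Bond Q) (X1, Y1, f) (X2, Y2, g) (X3, Y3, h)
        (chu_bond Q (X2, Y2, g) (X3, Y3, h) d) (chu_bond Q (X1, Y1, f) (X2, Y2, g) c)"
proof -
  obtain u v u' v' where cd: "c = (u, v)" "d = (u', v')" by (cases c; cases d)
  have a: "X1 \<in> Obj Q" "Y1 \<in> Obj Q" "X2 \<in> Obj Q" "Y2 \<in> Obj Q" "X3 \<in> Obj Q" "Y3 \<in> Obj Q"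
    "f \<in> carrier (Hom Q X1 Y1)" "g \<in> carrier (Hom Q X2 Y2)" "h \<in> carrier (Hom Q X3 Y3)"
    "u \<in> carrier (Hom Q X1 X2)" "v \<in> carrier (Hom Q Y1 Y2)"
    "u' \<in> carrier (Hom Q X2 X3)" "v' \<in> carrier (Hom Q Y2 Y3)"
    using assms by (auto simp: mem_arrows mem_chu_connections cd)
  let ?b = "limp Q X1 X2 Y1 f u"
  have b: "?b = rimp Q X2 Y1 Y2 v g"
    using c by (simp add: mem_chu_connections cd)
  have b_closed: "?b \<in> carrier (Hom Q X2 Y1)" using a by (intro limp_closed)
  have "rimp Q X3 Y1 Y2 (limp Q X2 Y1 Y2 g ?b) (limp Q X2 X3 Y2 g u')
      = limp Q X2 X3 Y1 (rimp Q X2 Y1 Y2 (limp Q X2 Y1 Y2 g ?b) g) u'"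
    using a b_closed by (intro limp_rimp_commute[symmetric] limp_closed)
  also have "rimp Q X2 Y1 Y2 (limp Q X2 Y1 Y2 g ?b) g = ?b"
    unfolding b using a by (intro rimp_limp_rimp)
  also have "limp Q X2 X3 Y1 ?b u' = limp Q X1 X3 Y1 f (Comp Q X1 X2 X3 u' u)"
    using a by (intro limp_Comp[symmetric])
  finally show ?thesis
    by (simp add: chu_bond_eq Comp_ChuCon Comp_Bond cd)
qed

text \<open>
  In \<open>Q\<close> the arrow \<open>f \<swarrow> \<Squnion>u\<close> is the greatest lower bound of the arrows \<open>f \<swarrow> u\<close>. Since it is a bond, it
  is also the greatest lower bound among bonds, which is a least upper bound for the reversed order.
\<close>

lemma chu_bond_lub:
  assumes F: "(X1, Y1, f) \<in> arrows Q" and G: "(X2, Y2, g) \<in> arrows Q"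
    and A: "A \<subseteq> chu_connections Q (X1, Y1, f) (X2, Y2, g)"
  shows "is_lub (Hom (Bond Q) (X1, Y1, f) (X2, Y2, g))
    (chu_bond Q (X1, Y1, f) (X2, Y2, g) (\<Squnion>\<^bsub>Hom (ChuCon Q) (X1, Y1, f) (X2, Y2, g)\<^esub> A))
    (chu_bond Q (X1, Y1, f) (X2, Y2, g) ` A)"
proof -
  let ?F = "(X1, Y1, f)" let ?G = "(X2, Y2, g)"
  interpret partial_order "Hom (Bond Q) ?F ?G"
    using F G by (rule Bond_partial_order)
  have a: "X1 \<in> Obj Q" "Y1 \<in> Obj Q" "X2 \<in> Obj Q" "Y2 \<in> Obj Q"
    "f \<in> carrier (Hom Q X1 Y1)" "g \<in> carrier (Hom Q X2 Y2)"
    using F G by (auto simp: mem_arrows)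
  have A': "fst ` A \<subseteq> carrier (Hom Q X1 X2)"
    using A by (auto simp: mem_chu_connections subset_iff)
  have image: "chu_bond Q ?F ?G ` A \<subseteq> bonds Q ?F ?G"
    using A chu_bond_image[OF F G] by blast
  have sup: "chu_bond Q ?F ?G (\<Squnion>\<^bsub>Hom (ChuCon Q) ?F ?G\<^esub> A) \<in> bonds Q ?F ?G"
    using sup_chu_connection[OF assms] ChuCon_sup[OF assms] chu_bond_image[OF F G] by (metis imageI)
  have "b \<sqsubseteq>\<^bsub>Hom Q X2 Y1\<^esub> chu_bond Q ?F ?G (\<Squnion>\<^bsub>Hom (ChuCon Q) ?F ?G\<^esub> A) \<longleftrightarrow>
      (\<forall>c\<in>A. b \<sqsubseteq>\<^bsub>Hom Q X2 Y1\<^esub> chu_bond Q ?F ?G c)" if "b \<in> bonds Q ?F ?G" for b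
    using that a A' by (simp add: ChuCon_sup[OF assms] chu_bond_eq le_limp_sup_iff mem_bonds)
  then show ?thesis
    using image sup by (subst is_lub_iff) (simp_all add: carrier_Bond le_Bond)
qed

lemma chu_bond_full_image: "full_quantaloid_image (ChuCon Q) (Bond Q) (chu_bond Q)"
proof (intro full_quantaloid_image.intro full_quantaloid_image_axioms.intro ChuCon_quantaloid,
    unfold Obj_ChuCon Obj_Bond carrier_ChuCon carrier_Bond)
  show "arrows Q = arrows Q" ..
next
  fix F G assume FG: "F \<in> arrows Q" "G \<in> arrows Q"
  then show "partial_order (Hom (Bond Q) F G)" by (rule Bond_partial_order)
  show "chu_bond Q F G ` chu_connections Q F G = bonds Q F G"
    using FG by (cases F; cases G) (simp add: chu_bond_image)
  fix A assume "A \<subseteq> chu_connections Q F G"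
  with FG show "is_lub (Hom (Bond Q) F G) (chu_bond Q F G (\<Squnion>\<^bsub>Hom (ChuCon Q) F G\<^esub> A)) (chu_bond Q F G ` A)"
    by (cases F; cases G) (simp only: chu_bond_lub)
next
  fix F G H c d
  assume "F \<in> arrows Q" "G \<in> arrows Q" "H \<in> arrows Q"
    "c \<in> chu_connections Q F G" "d \<in> chu_connections Q G H"
  then show "chu_bond Q F H (Comp (ChuCon Q) F G H d c) =
      Comp (Bond Q) F G H (chu_bond Q G H d) (chu_bond Q F G c)"
    by (cases F; cases G; cases H) (simp only: chu_bond_Comp)
next
  fix F assume "F \<in> arrows Q"
  then show "chu_bond Q F F (Ident (ChuCon Q) F) = Ident (Bond Q) F"
    by (cases F) (simp add: chu_bond_eq Ident_ChuCon Ident_Bond mem_arrows limp_Ident)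
qed

lemma chu_equiv_kernel:
  "chu_equiv Q F G = {(c, d). c \<in> chu_connections Q F G \<and> d \<in> chu_connections Q F G \<and>
    chu_bond Q F G c = chu_bond Q F G d}"
  by (cases F; cases G) (auto simp: chu_equiv_def chu_bond_eq)

end


section \<open>The isomorphism\<close>

theorem proposition2p3p5:
  fixes Q :: "('o, 'a) quantaloid_data"
  assumes "quantaloid Q"
  shows "quantaloid_isomorphic (B_quantaloid Q) (Bond Q)"
proof -
  interpret quantaloid Q by (rule assms)
  interpret full_quantaloid_image "ChuCon Q" "Bond Q" "chu_bond Q"
    by (rule chu_bond_full_image)
  show ?thesis
    unfolding B_quantaloid_def
    by (rule quotient_isomorphic) (simp add: chu_equiv_kernel carrier_ChuCon)
qed

end
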